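(* Let $f,g:\mathbb{R}^2\to\mathbb{R}$ be real analytic functions, $2\pi$-periodic in the first variable, with bounded $C^2$-norm. There exist constants $\varepsilon_0>0$, $\eta_0>0$ and $K>0$ such that for every $\nu\in\mathbb{R}$, every $0<\varepsilon\le\varepsilon_0$ and every $\eta$ with $K\sqrt{\varepsilon}\le\eta\le\eta_0$, the map $Q:\mathbb{T}\times\mathbb{R}\to\mathbb{T}\times\mathbb{R}$, $$Q(\theta,\rho)=\Big(\theta+2\pi\nu+\tfrac{1-e^{-2\pi\eta}}{\eta}\,\rho+\varepsilon f(\theta,\rho),\ \rho e^{-2\pi\eta}+\varepsilon g(\theta,\rho)\Big),$$ possesses a unique invariant attractive $C^1$-circle in the vicinity of $C_0=\mathbb{T}\times\{\rho=0\}$ (that is, in $\mathbb{T}\times[-1,1]$), and the basin of attraction of this circle is the whole cylinder $\mathbb{T}\times\mathbb{R}$.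
   Context: $\mathbb{T}=\mathbb{R}/2\pi\mathbb{Z}$. For $\varepsilon=0$ the map $Q$ reduces to the twist map $P(\theta,\rho)=(\theta+2\pi\nu+\frac{1-e^{-2\pi\eta}}{\eta}\rho,\ \rho e^{-2\pi\eta})$, for which $C_0$ is invariant and normally attractive when $\eta>0$. The parameters are a frequency $\nu\in\mathbb{R}$ and a dissipation $\eta>0$. A $C^1$-circle here is a curve of the form $\{(\theta,\varphi(\theta)):\theta\in\mathbb{T}\}$ with $\varphi:\mathbb{T}\to\mathbb{R}$ of class $C^1$. The basin of attraction of an invariant circle is the set of points whose forward orbit under $Q$ has distance to the circle tending to $0$. *)

theory Defs
  imports "HOL-Analysis.Analysis"
begin

section \<open>The circle of angles modulo \<open>2\<pi>\<close>\<close>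

quotient_type circle = real / "\<lambda>x y :: real. \<exists>k::int. x - y = 2 * pi * of_int k"
  morphisms circle_rep angle
proof (rule equivpI)
  show "reflp (\<lambda>x y :: real. \<exists>k::int. x - y = 2 * pi * of_int k)"
    by (rule reflpI, rule exI[of _ 0]) simp
  show "symp (\<lambda>x y :: real. \<exists>k::int. x - y = 2 * pi * of_int k)"
  proof (rule sympI)
    fix x y :: real
    assume "\<exists>k::int. x - y = 2 * pi * of_int k"
    then obtain k :: int where "x - y = 2 * pi * of_int k" ..
    then have "y - x = 2 * pi * of_int (- k)" by simp
    then show "\<exists>k::int. y - x = 2 * pi * of_int k" ..
  qed
  show "transp (\<lambda>x y :: real. \<exists>k::int. x - y = 2 * pi * of_int k)"
  proof (rule transpI)
    fix x y z :: real
    assume "\<exists>k::int. x - y = 2 * pi * of_int k" "\<exists>k::int. y - z = 2 * pi * of_int k"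
    then obtain k l :: int where "x - y = 2 * pi * of_int k" "y - z = 2 * pi * of_int l"
      by blast
    then have "x - z = 2 * pi * of_int (k + l)" by (simp add: algebra_simps)
    then show "\<exists>k::int. x - z = 2 * pi * of_int k" ..
  qed
qed

lemma angle_eq_iff: "angle x = angle y \<longleftrightarrow> (\<exists>k::int. x - y = 2 * pi * of_int k)"
  by (rule circle.abs_eq_iff)

lemma angle_circle_rep [simp]: "angle (circle_rep t) = t"
  by (rule Quotient3_abs_rep[OF Quotient3_circle])

lemma angle_shift [simp]: "angle (x + 2 * pi * of_int k) = angle x"
  by (auto simp: angle_eq_iff)

instantiation circle :: metric_space
begin

definition dist_circle_def:
  "dist s t = Inf {\<bar>x - y\<bar> | x y. angle x = s \<and> angle y = t}"

definition uniformity_circle_def: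
  "(uniformity :: (circle \<times> circle) filter) = (INF e\<in>{0 <..}. principal {(x, y). dist x y < e})"

definition open_circle_def:
  "open (U :: circle set) \<longleftrightarrow> (\<forall>x\<in>U. eventually (\<lambda>(x', y). x' = x \<longrightarrow> y \<in> U) uniformity)"

lemma dist_circle_le: "dist (angle x) (angle y) \<le> \<bar>x - y\<bar>"
  unfolding dist_circle_def by (rule cInf_lower) (auto intro!: bdd_belowI[of _ 0])

text \<open>The infimum is attained, and the representative of one of the points may be prescribed.\<close>

lemma dist_circle_attained:
  obtains y where "angle y = t" "dist (angle x) t = \<bar>x - y\<bar>"
proof -
  obtain y0 where y0: "angle y0 = t" by (metis angle_circle_rep)
  define z where "z = (x - y0) / (2 * pi)"
  define y where "y = y0 + 2 * pi * of_int (round z)"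
  have y: "angle y = t" unfolding y_def using y0 by simp
  have "\<bar>x - y\<bar> \<le> \<bar>u - v\<bar>" if u: "angle u = angle x" and v: "angle v = t" for u v
  proof -
    from u obtain k :: int where k: "u - x = 2 * pi * of_int k" by (auto simp: angle_eq_iff)
    from v y0 have "angle v = angle y0" by simp
    then obtain l :: int where l: "v - y0 = 2 * pi * of_int l" by (auto simp: angle_eq_iff)
    have xy: "x - y0 = 2 * pi * z" by (simp add: z_def)
    have "\<bar>x - y\<bar> = 2 * pi * \<bar>z - of_int (round z)\<bar>"
    proof -
      have "x - y = 2 * pi * (z - of_int (round z))"
        using xy by (simp add: y_def algebra_simps)
      then show ?thesis by (simp add: abs_mult)
    qed
    also have "\<dots> \<le> 2 * pi * \<bar>z - of_int (l - k)\<bar>"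
      by (intro mult_left_mono round_diff_minimal) auto
    also have "\<dots> = \<bar>u - v\<bar>"
    proof -
      have "u - v = 2 * pi * (z - of_int (l - k))"
        using xy k l by (simp add: algebra_simps)
      then show ?thesis by (simp add: abs_mult)
    qed
    finally show ?thesis .
  qed
  then have "\<bar>x - y\<bar> \<le> dist (angle x) t"
    unfolding dist_circle_def using y by (intro cInf_greatest) auto
  with dist_circle_le[of x y] y have "dist (angle x) t = \<bar>x - y\<bar>" by simp
  with y that show thesis by blast
qed

instance
proof
  show "uniformity = (INF e\<in>{0 <..}. principal {(x, y :: circle). dist x y < e})"
    by (rule uniformity_circle_def)
  show "open U \<longleftrightarrow> (\<forall>x\<in>U. eventually (\<lambda>(x', y). x' = x \<longrightarrow> y \<in> U) uniformity)"
    for U :: "circle set"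
    by (rule open_circle_def)
  show "dist s t = 0 \<longleftrightarrow> s = t" for s t :: circle
  proof
    obtain x y where "angle x = s" "angle y = t" "dist s t = \<bar>x - y\<bar>"
      by (metis angle_circle_rep dist_circle_attained)
    then show "s = t" if "dist s t = 0" using that by auto
    show "dist s t = 0" if "s = t"
    proof -
      have "dist s t \<le> 0"
        using dist_circle_le[of "circle_rep s" "circle_rep s"] that by simp
      with \<open>dist s t = \<bar>x - y\<bar>\<close> show ?thesis by simp
    qed
  qed
  show "dist s t \<le> dist s r + dist t r" for s t r :: circle
  proof -
    obtain z where z: "angle z = r" by (metis angle_circle_rep)
    have sym: "dist p q = dist q p" for p q :: circle
    proof -
      have "{\<bar>x - y\<bar> | x y. angle x = p \<and> angle y = q} =
          {\<bar>x - y\<bar> | x y. angle x = q \<and> angle y = p}"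
        using abs_minus_commute by blast
      then show ?thesis by (simp add: dist_circle_def)
    qed
    obtain x where x: "angle x = s" "dist r s = \<bar>z - x\<bar>"
      using dist_circle_attained z by metis
    obtain y where y: "angle y = t" "dist r t = \<bar>z - y\<bar>"
      using dist_circle_attained z by metis
    have "dist s t \<le> \<bar>x - y\<bar>" using dist_circle_le[of x y] x y by simp
    also have "\<dots> \<le> dist r s + dist r t" using x y by simp
    finally show ?thesis by (simp add: sym[of s r] sym[of t r])
  qed
qed

end


section \<open>Analyticity and the \<open>C\<^sup>2\<close>-norm\<close>

text \<open>Local expansion into an (unconditionally convergent) double power series at every point.\<close>

definition real_analytic2 :: "(real \<times> real \<Rightarrow> real) \<Rightarrow> bool" where
  "real_analytic2 f \<longleftrightarrow>
     (\<forall>a b. \<exists>c :: nat \<Rightarrow> nat \<Rightarrow> real. \<exists>r>0. \<forall>x y. \<bar>x - a\<bar> < r \<and> \<bar>y - b\<bar> < r \<longrightarrow>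
        ((\<lambda>(i, j). c i j * (x - a) ^ i * (y - b) ^ j) has_sum f (x, y)) UNIV)"

definition periodic_fst :: "(real \<times> real \<Rightarrow> real) \<Rightarrow> bool" where
  "periodic_fst f \<longleftrightarrow> (\<forall>x y. f (x + 2 * pi, y) = f (x, y))"

text \<open>\<open>f\<close> is of class \<open>C\<^sup>2\<close> and \<open>f\<close>, its first derivative and its second derivative (with
  the operator norms) are bounded on the whole plane.\<close>

definition bounded_C2_norm :: "(real \<times> real \<Rightarrow> real) \<Rightarrow> bool" where
  "bounded_C2_norm f \<longleftrightarrow>
     (\<exists>(D1 :: real \<times> real \<Rightarrow> (real \<times> real) \<Rightarrow>\<^sub>L real)
       (D2 :: real \<times> real \<Rightarrow> (real \<times> real) \<Rightarrow>\<^sub>L (real \<times> real) \<Rightarrow>\<^sub>L real).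
        (\<forall>p. (f has_derivative blinfun_apply (D1 p)) (at p)) \<and>
        (\<forall>p. (D1 has_derivative blinfun_apply (D2 p)) (at p)) \<and>
        continuous_on UNIV D2 \<and>
        bounded (range f) \<and> bounded (range D1) \<and> bounded (range D2))"


section \<open>The map on the cylinder, invariant circles and basins\<close>

text \<open>The formula is evaluated at a representative of the angle; for \<open>f\<close> and \<open>g\<close> periodic in the
  first variable the choice is irrelevant, see \<open>Qmap_angle\<close> below.\<close>

definition Qmap :: "(real \<times> real \<Rightarrow> real) \<Rightarrow> (real \<times> real \<Rightarrow> real) \<Rightarrow> real \<Rightarrow> real \<Rightarrow> real \<Rightarrow>
    circle \<times> real \<Rightarrow> circle \<times> real" where
  "Qmap f g \<nu> \<epsilon> \<eta> = (\<lambda>(t, \<rho>). let \<theta> = circle_rep t in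
     (angle (\<theta> + 2 * pi * \<nu> + (1 - exp (- 2 * pi * \<eta>)) / \<eta> * \<rho> + \<epsilon> * f (\<theta>, \<rho>)),
      \<rho> * exp (- 2 * pi * \<eta>) + \<epsilon> * g (\<theta>, \<rho>)))"

lemma periodic_fst_int:
  assumes "periodic_fst f"
  shows "f (x + 2 * pi * of_int k, y) = f (x, y)"
proof (induction k rule: int_induct[where k = 0])
  case base
  show ?case by simp
next
  case (step1 i)
  have "f (x + 2 * pi * of_int (i + 1), y) = f ((x + 2 * pi * of_int i) + 2 * pi, y)"
    by (simp add: algebra_simps)
  with assms step1 show ?case unfolding periodic_fst_def by metis
next
  case (step2 i)
  have "f (x + 2 * pi * of_int i, y) = f ((x + 2 * pi * of_int (i - 1)) + 2 * pi, y)"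
    by (simp add: algebra_simps)
  with assms step2 show ?case unfolding periodic_fst_def by metis
qed

lemma Qmap_angle:
  assumes "periodic_fst f" "periodic_fst g"
  shows "Qmap f g \<nu> \<epsilon> \<eta> (angle \<theta>, \<rho>) =
    (angle (\<theta> + 2 * pi * \<nu> + (1 - exp (- 2 * pi * \<eta>)) / \<eta> * \<rho> + \<epsilon> * f (\<theta>, \<rho>)),
     \<rho> * exp (- 2 * pi * \<eta>) + \<epsilon> * g (\<theta>, \<rho>))"
proof -
  have "angle (circle_rep (angle \<theta>)) = angle \<theta>" by simp
  then obtain k :: int where "circle_rep (angle \<theta>) - \<theta> = 2 * pi * of_int k"
    unfolding angle_eq_iff by blast
  then have "circle_rep (angle \<theta>) = \<theta> + 2 * pi * of_int k" by simp
  moreover have "angle (\<theta> + 2 * pi * of_int k + 2 * pi * \<nu> + u + v) = angle (\<theta> + 2 * pi * \<nu> + u + v)"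
    for u v
    using angle_shift[of "\<theta> + 2 * pi * \<nu> + u + v" k] by (simp add: algebra_simps)
  ultimately show ?thesis
    by (simp add: Qmap_def Let_def periodic_fst_int[OF assms(1)] periodic_fst_int[OF assms(2)])
qed

definition C1_circle :: "(circle \<times> real) set \<Rightarrow> bool" where
  "C1_circle C \<longleftrightarrow> (\<exists>\<phi> :: circle \<Rightarrow> real.
     (\<lambda>\<theta>. \<phi> (angle \<theta>)) C1_differentiable_on UNIV \<and> C = {(t, \<phi> t) | t. True})"

definition invariant :: "('a \<Rightarrow> 'a) \<Rightarrow> 'a set \<Rightarrow> bool" where
  "invariant Q C \<longleftrightarrow> Q ` C = C"

definition basin :: "('a::metric_space \<Rightarrow> 'a) \<Rightarrow> 'a set \<Rightarrow> 'a set" where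
  "basin Q C = {p. (\<lambda>n. infdist ((Q ^^ n) p) C) \<longlonglongrightarrow> 0}"

definition attractive :: "('a::metric_space \<Rightarrow> 'a) \<Rightarrow> 'a set \<Rightarrow> bool" where
  "attractive Q C \<longleftrightarrow> (\<exists>U. open U \<and> C \<subseteq> U \<and> U \<subseteq> basin Q C)"

end

theory Submission
  imports Defs
begin

text \<open>
  On the lift to the plane, the graph transform \<open>\<phi> \<mapsto> v \<circ> u\<inverse>\<close>, where \<open>(u x, v x)\<close> is the image of
  \<open>(x, \<phi> x)\<close>, preserves the periodic functions with \<open>\<bar>\<phi>\<bar> \<le> 1\<close>, \<open>\<bar>\<phi>'\<bar> \<le> L = \<eta> / 14\<close> and \<open>\<phi>'\<close>
  1-Lipschitz: the twist costs terms of order \<open>L\<close> and \<open>L\<^sup>2\<close>, the perturbation terms of order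
  \<open>\<epsilon>\<close>, and both are absorbed by the contraction \<open>1 - e\<^sup>-\<^sup>2\<^sup>\<pi>\<^sup>\<eta> \<ge> 3\<eta>\<close> as soon as \<open>\<epsilon>\<close> is small compared with
  \<open>\<eta>\<^sup>2\<close>. The vertical distance to an \<open>L\<close>-Lipschitz graph contracts by a
  uniform factor, whatever the height of the point. This makes the graph transform a
  contraction in the sup norm, puts every point in the basin of the invariant graph, and excludes
  any other bounded invariant set that is a graph. The limit graph is of class \<open>C\<^sup>1\<close> because the
  derivatives of the iterates are equi-Lipschitz.
\<close>

section \<open>Functions with Lipschitz derivative\<close>

text \<open>Difference quotients with a fixed step \<open>s\<close> approximate all the derivatives \<open>w n\<close> up to
  \<open>B * s\<close>, so uniform convergence of the functions forces uniform convergence of the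
  derivatives.\<close>

lemma lipschitz_derivatives_uniformly_Cauchy:
  fixes \<phi> w :: "nat \<Rightarrow> real \<Rightarrow> real"
  assumes der: "\<And>n x. (\<phi> n has_real_derivative w n x) (at x)"
    and lip: "\<And>n. B-lipschitz_on UNIV (w n)"
    and lim: "uniform_limit UNIV \<phi> \<psi> sequentially"
  shows "uniformly_Cauchy_on UNIV w"
proof (rule uniformly_Cauchy_onI)
  fix e :: real assume e: "e > 0"
  have B: "B \<ge> 0" using lip[of 0] by (rule lipschitz_on_nonneg)
  \<comment> \<open>\<open>B + 1\<close> avoids division by zero. The two quotient errors together
    cost at most \<open>e / 2\<close>, and the four function values at tolerance
    \<open>e * s / 10\<close> cost \<open>4 * e / 10\<close>.\<close>
  define s where "s = e / (4 * (B + 1))"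
  have s: "s > 0" using e B by (simp add: s_def)
  have Bs: "2 * (B * s) \<le> e / 2"
    using e B by (simp add: s_def field_simps)
  have "e * s / 10 > 0" using e s by simp
  then have "eventually (\<lambda>n. \<forall>x\<in>UNIV. dist (\<phi> n x) (\<psi> x) < e * s / 10) sequentially"
    by (rule uniform_limitD[OF lim])
  then obtain N where N: "\<And>n x. n \<ge> N \<Longrightarrow> \<bar>\<phi> n x - \<psi> x\<bar> < e * s / 10"
    by (auto simp: eventually_sequentially dist_real_def)
  have quot: "\<bar>\<phi> n (x + s) - \<phi> n x - s * w n x\<bar> \<le> s * (B * s)" for n x
  proof -
    obtain z where z: "x < z" "z < x + s" "\<phi> n (x + s) - \<phi> n x = s * w n z"
      using MVT2[of x "x + s" "\<phi> n" "w n"] s der by auto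
    have "\<bar>w n z - w n x\<bar> \<le> B * \<bar>z - x\<bar>"
      using lipschitz_onD[OF lip[of n], of z x] by (simp add: dist_real_def)
    also have "\<dots> \<le> B * s" using z B by (intro mult_left_mono) auto
    finally have "s * \<bar>w n z - w n x\<bar> \<le> s * (B * s)" using s by (intro mult_left_mono) auto
    moreover have "\<phi> n (x + s) - \<phi> n x - s * w n x = s * (w n z - w n x)"
      using z by (simp add: algebra_simps)
    ultimately show ?thesis using s by (simp add: abs_mult)
  qed
  have "dist (w m x) (w n x) < e" if "m \<ge> N" "n \<ge> N" for m n x
  proof -
    have "s * \<bar>w m x - w n x\<bar> = \<bar>s * w m x - s * w n x\<bar>"
      using s by (simp add: abs_mult flip: right_diff_distrib)
    also have "\<dots> \<le> 2 * (s * (B * s)) + 4 * (e * s / 10)"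
      using quot[of m x] quot[of n x] N[OF that(1), of x] N[OF that(2), of x]
        N[OF that(1), of "x + s"] N[OF that(2), of "x + s"]
      unfolding abs_le_iff abs_less_iff by linarith
    also have "\<dots> = s * (2 * (B * s) + 4 * e / 10)" by (simp add: algebra_simps)
    also have "\<dots> < s * e" using Bs e s by (intro mult_strict_left_mono) auto
    finally show ?thesis using s by (simp add: dist_real_def)
  qed
  then show "\<exists>M. \<forall>x\<in>UNIV. \<forall>m\<ge>M. \<forall>n\<ge>M. dist (w m x) (w n x) < e" by blast
qed

text \<open>The derivatives converge uniformly, so termwise differentiation applies; the limit
  \<open>h\<close> it yields is \<open>\<psi>\<close> by uniqueness of limits.\<close>

lemma uniform_limit_lipschitz_derivatives:
  fixes \<phi> w :: "nat \<Rightarrow> real \<Rightarrow> real"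
  assumes der: "\<And>n x. (\<phi> n has_real_derivative w n x) (at x)"
    and lip: "\<And>n. B-lipschitz_on UNIV (w n)"
    and lim: "uniform_limit UNIV \<phi> \<psi> sequentially"
  obtains w' where "\<And>x. (\<psi> has_real_derivative w' x) (at x)" "\<And>x. (\<lambda>n. w n x) \<longlonglongrightarrow> w' x"
proof -
  have "uniformly_convergent_on UNIV w"
    using lipschitz_derivatives_uniformly_Cauchy[OF assms] by (rule Cauchy_uniformly_convergent)
  then obtain w' where w': "uniform_limit UNIV w w' sequentially"
    unfolding uniformly_convergent_on_def by blast
  have lim': "(\<lambda>n. \<phi> n x) \<longlonglongrightarrow> \<psi> x" for x
    by (rule tendsto_uniform_limitI[OF lim]) simp
  have "\<exists>h. \<forall>x\<in>UNIV. (\<lambda>n. \<phi> n x) \<longlonglongrightarrow> h x \<and> (h has_derivative (\<lambda>t. w' x * t)) (at x within UNIV)"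
  proof (rule has_derivative_sequence[where f' = "\<lambda>n x t. w n x * t"])
    show "(\<phi> n has_derivative (\<lambda>t. w n x * t)) (at x within UNIV)" for n x
      using der[of n x] by (simp add: has_field_derivative_def)
    show "\<forall>\<^sub>F n in sequentially. \<forall>x\<in>UNIV. \<forall>h. norm (w n x * h - w' x * h) \<le> e * norm h"
      if "e > 0" for e
      using uniform_limitD[OF w' that]
    proof eventually_elim
      case (elim n)
      have "\<bar>w n x - w' x\<bar> * \<bar>h\<bar> \<le> e * \<bar>h\<bar>" for x h
        using elim by (intro mult_right_mono) (auto simp: dist_real_def less_imp_le)
      then show ?case by (simp add: abs_mult flip: left_diff_distrib)
    qed
    show "(\<lambda>n. \<phi> n 0) \<longlonglongrightarrow> \<psi> 0" "(0 :: real) \<in> UNIV" by (rule lim', simp)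
  qed auto
  then obtain h where h: "\<And>x. (\<lambda>n. \<phi> n x) \<longlonglongrightarrow> h x"
      "\<And>x. (h has_derivative (\<lambda>t. w' x * t)) (at x)"
    by auto
  have "h = \<psi>" using LIMSEQ_unique[OF h(1) lim'] by blast
  then have "(\<psi> has_real_derivative w' x) (at x)" for x
    using h(2)[of x] by (simp add: has_field_derivative_def)
  moreover have "(\<lambda>n. w n x) \<longlonglongrightarrow> w' x" for x
    by (rule tendsto_uniform_limitI[OF w']) simp
  ultimately show thesis using that by blast
qed

section \<open>Functions with derivative bounded below by a positive constant\<close>

lemma derivative_bounded_below_expanding:
  fixes u u' :: "real \<Rightarrow> real"
  assumes der: "\<And>x. (u has_real_derivative u' x) (at x)"
    and low: "\<And>x. d \<le> u' x" and "0 < d"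
  shows "d * \<bar>x - y\<bar> \<le> \<bar>u x - u y\<bar>"
proof -
  have *: "d * \<bar>x - y\<bar> \<le> \<bar>u x - u y\<bar>" if "x < y" for x y
  proof -
    note less = that
    obtain z where "u y - u x = (y - x) * u' z"
      using MVT2[OF less der] by blast
    then have "u y - u x \<ge> (y - x) * d" using that low[of z] by simp
    then show ?thesis using that by (simp add: mult.commute)
  qed
  show ?thesis
    using *[of x y] *[of y x] by (cases x y rule: linorder_cases) (auto simp: abs_minus_commute)
qed

text \<open>Expansion gives injectivity and makes \<open>u\<close> unbounded in both directions; the
  intermediate value theorem does the rest.\<close>

lemma derivative_bounded_below_bij:
  fixes u u' :: "real \<Rightarrow> real"
  assumes der: "\<And>x. (u has_real_derivative u' x) (at x)"
    and low: "\<And>x. d \<le> u' x" and d: "0 < d"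
  shows "bij u"
proof (rule bijI)
  note ex = derivative_bounded_below_expanding[OF assms]
  show "inj u"
  proof (rule injI)
    fix x y assume "u x = u y"
    then show "x = y" using ex[of x y] d by (simp add: mult_le_0_iff)
  qed
  have mono: "u x \<le> u y" if "x \<le> y" for x y
    using DERIV_nonneg_imp_nondecreasing[OF that, of u] der low d by (meson less_le_trans less_imp_le)
  have "\<exists>x. u x = y" for y
  proof -
    \<comment> \<open>With this radius, \<open>u (-r)\<close> and \<open>u r\<close> are at least
      \<open>\<bar>y - u 0\<bar>\<close> away from \<open>u 0\<close>, on opposite sides.\<close>
    define r where "r = \<bar>y - u 0\<bar> / d"
    have r: "r \<ge> 0" "d * r = \<bar>y - u 0\<bar>" using d by (auto simp: r_def)
    have "u (-r) \<le> y" using ex[of "-r" 0] mono[of "-r" 0] r by auto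
    moreover have "y \<le> u r" using ex[of r 0] mono[of 0 r] r by auto
    moreover have "continuous_on {-r..r} u"
      using der by (meson DERIV_isCont continuous_at_imp_continuous_on)
    ultimately show ?thesis using IVT'[of u "-r" y r] r by auto
  qed
  then show "surj u" by (metis surjI)
qed

text \<open>Expansion of \<open>u\<close> is a Lipschitz bound for \<open>inv u\<close>, which
  supplies the continuity that the inverse function rule requires.\<close>

lemma derivative_bounded_below_inv:
  fixes u u' :: "real \<Rightarrow> real"
  assumes der: "\<And>x. (u has_real_derivative u' x) (at x)"
    and low: "\<And>x. d \<le> u' x" and d: "0 < d"
  shows "(inv u has_real_derivative inverse (u' (inv u x))) (at x)"
proof -
  have bij: "bij u" by (rule derivative_bounded_below_bij[OF assms])
  have ui: "u (inv u y) = y" for y using bij by (simp add: bij_is_surj surj_f_inv_f)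
  have "(1 / d)-lipschitz_on UNIV (inv u)"
  proof (rule lipschitz_onI)
    fix x y
    show "dist (inv u x) (inv u y) \<le> 1 / d * dist x y"
      using derivative_bounded_below_expanding[OF assms, of "inv u x" "inv u y"] d
      by (simp add: ui dist_real_def field_simps)
  qed (use d in simp)
  then have cont: "isCont (inv u) x"
    using lipschitz_on_continuous_on continuous_on_eq_continuous_at open_UNIV by blast
  show ?thesis
    by (rule DERIV_inverse_function[where f = u and a = "x - 1" and b = "x + 1"])
      (use der low[of "inv u x"] d ui cont in auto)
qed

section \<open>The graph transform of a dissipative twist map\<close>

text \<open>Here \<open>f\<close> and \<open>g\<close> are the perturbations with the factor
  \<open>\<epsilon>\<close> included, of size \<open>m\<close>; \<open>c\<close> is the rotation,
  \<open>a\<close> the twist and \<open>lam\<close> the contraction. The last five conditions keep,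
  in order, \<open>base\<close> increasing, slopes below \<open>L\<close>, derivatives 1-Lipschitz,
  heights below 1, and vertical distances contracting.\<close>

locale dissipative_twist =
  fixes f g :: "real \<times> real \<Rightarrow> real"
    and Df Dg :: "real \<times> real \<Rightarrow> (real \<times> real) \<Rightarrow>\<^sub>L real"
    and c a lam m L :: real
  assumes periodic: "periodic_fst f" "periodic_fst g"
    and derivative: "\<And>p. (f has_derivative Df p) (at p)" "\<And>p. (g has_derivative Dg p) (at p)"
    and derivative_bound: "\<And>p. norm (Df p) \<le> m" "\<And>p. norm (Dg p) \<le> m"
    and derivative_lipschitz: "m-lipschitz_on UNIV Df" "m-lipschitz_on UNIV Dg"
    and g_bound: "\<And>p. \<bar>g p\<bar> \<le> m"
    and nonneg: "0 \<le> lam" "0 \<le> a" "0 \<le> L"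
    and L_le: "L \<le> 1"
    and base_expansion: "0 < 1 - a * L - 2 * m"
    and slope_condition: "lam * L + 2 * m \<le> L * (1 - a * L - 2 * m)"
    and curvature_condition: "lam + 5 * m + L * (a + 5 * m) \<le> (1 - a * L - 2 * m)\<^sup>2"
    and height_condition: "lam + m \<le> 1"
    and contraction_condition: "lam + m + L * (a + m) < 1"
begin

text \<open>The angle is left on the real line, not reduced modulo the period, so that
  \<open>base \<phi>\<close> has an inverse function there.\<close>

definition base :: "(real \<Rightarrow> real) \<Rightarrow> real \<Rightarrow> real" where
  "base \<phi> x = x + c + a * \<phi> x + f (x, \<phi> x)"

definition fibre :: "(real \<Rightarrow> real) \<Rightarrow> real \<Rightarrow> real" where
  "fibre \<phi> x = lam * \<phi> x + g (x, \<phi> x)"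

definition transform :: "(real \<Rightarrow> real) \<Rightarrow> real \<Rightarrow> real" where
  "transform \<phi> x = fibre \<phi> (inv (base \<phi>) x)"

text \<open>The derivative is a separate argument because its bounds must be carried to the limit of
  the iterates.\<close>

definition admissible :: "(real \<Rightarrow> real) \<Rightarrow> (real \<Rightarrow> real) \<Rightarrow> bool" where
  "admissible \<phi> w \<longleftrightarrow> (\<forall>x. \<phi> (x + 2 * pi) = \<phi> x) \<and> (\<forall>x. \<bar>\<phi> x\<bar> \<le> 1) \<and>
     (\<forall>x. (\<phi> has_real_derivative w x) (at x)) \<and> (\<forall>x. \<bar>w x\<bar> \<le> L) \<and> 1-lipschitz_on UNIV w"

text \<open>For two points on one vertical line, \<open>lam + m\<close> accounts for the new heights
  and \<open>L * (a + m)\<close> for the change of the graph over their horizontal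
  separation.\<close>

definition rate :: real where
  "rate = lam + m + L * (a + m)"

lemma m_nonneg: "0 \<le> m"
  using g_bound[of 0] by simp

lemma rate_bounds: "0 \<le> rate" "rate < 1"
  using nonneg m_nonneg contraction_condition by (auto simp: rate_def)

lemma admissible_lipschitz:
  assumes "admissible \<phi> w"
  shows "\<bar>\<phi> x - \<phi> y\<bar> \<le> L * \<bar>x - y\<bar>"
proof -
  have "norm (\<phi> x - \<phi> y) \<le> L * norm (x - y)"
    using assms by (intro field_differentiable_bound[where S = UNIV and f' = w])
      (auto simp: admissible_def)
  then show ?thesis by simp
qed

text \<open>The tangent vector \<open>(1, w x)\<close> has norm at most 2, whence
  \<open>2 * m\<close>. In \<open>5 * m\<close>, a share \<open>4 * m\<close> comes from moving the
  point on the graph by at most \<open>2 * \<bar>x - y\<bar>\<close> and \<open>m\<close> from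
  turning the tangent vector.\<close>

lemma derivative_along_graph:
  fixes h :: "real \<times> real \<Rightarrow> real"
  assumes adm: "admissible \<phi> w"
    and der: "\<And>p. (h has_derivative blinfun_apply (Dh p)) (at p)"
    and bound: "\<And>p. norm (Dh p) \<le> m"
    and lip: "m-lipschitz_on UNIV Dh"
  obtains h' where "\<And>x. ((\<lambda>x. h (x, \<phi> x)) has_real_derivative h' x) (at x)"
    "\<And>x. \<bar>h' x\<bar> \<le> 2 * m" "\<And>x y. \<bar>h' x - h' y\<bar> \<le> 5 * m * \<bar>x - y\<bar>"
proof -
  define h' where "h' x = Dh (x, \<phi> x) (1, w x)" for x
  have w: "\<bar>w x\<bar> \<le> 1" for x
    using adm L_le by (auto simp: admissible_def intro: order_trans)
  have vec: "norm (1 :: real, w x) \<le> 2" for x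
    using norm_Pair_le[of "1 :: real" "w x"] w[of x] by simp
  have \<phi>: "(\<phi> has_derivative (\<lambda>t. t * w x)) (at x)" for x
    using adm by (simp add: admissible_def has_field_derivative_def mult_commute_abs)
  have "((\<lambda>x. h (x, \<phi> x)) has_derivative (\<lambda>t. Dh (x, \<phi> x) (t, t * w x))) (at x)" for x
    by (rule has_derivative_compose[OF has_derivative_Pair[OF has_derivative_ident \<phi>] der])
  moreover have "Dh (x, \<phi> x) (t, t * w x) = h' x * t" for x t
  proof -
    have "Dh (x, \<phi> x) (t *\<^sub>R (1, w x)) = t *\<^sub>R Dh (x, \<phi> x) (1, w x)"
      by (rule blinfun.scaleR_right)
    then show ?thesis by (simp add: h'_def)
  qed
  ultimately have "((\<lambda>x. h (x, \<phi> x)) has_real_derivative h' x) (at x)" for x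
    by (simp add: has_field_derivative_def)
  moreover have "\<bar>h' x\<bar> \<le> 2 * m" for x
  proof -
    have "\<bar>h' x\<bar> \<le> norm (Dh (x, \<phi> x)) * norm (1 :: real, w x)"
      unfolding h'_def using norm_blinfun[of "Dh (x, \<phi> x)"] by simp
    also have "\<dots> \<le> m * 2" by (intro mult_mono bound vec m_nonneg) simp
    finally show ?thesis by simp
  qed
  moreover have "\<bar>h' x - h' y\<bar> \<le> 5 * m * \<bar>x - y\<bar>" for x y
  proof -
    have "h' x - h' y = (Dh (x, \<phi> x) - Dh (y, \<phi> y)) (1, w x) + Dh (y, \<phi> y) (0, w x - w y)"
      using blinfun.diff_right[of "Dh (y, \<phi> y)" "(1, w x)" "(1, w y)"]
      by (simp add: h'_def blinfun.diff_left)
    then have "\<bar>h' x - h' y\<bar> \<le> \<bar>(Dh (x, \<phi> x) - Dh (y, \<phi> y)) (1, w x)\<bar>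
        + \<bar>Dh (y, \<phi> y) (0, w x - w y)\<bar>"
      by simp
    also have "\<dots> \<le> norm (Dh (x, \<phi> x) - Dh (y, \<phi> y)) * norm (1 :: real, w x)
        + norm (Dh (y, \<phi> y)) * norm (0 :: real, w x - w y)"
      using norm_blinfun[of "Dh (x, \<phi> x) - Dh (y, \<phi> y)" "(1, w x)"]
        norm_blinfun[of "Dh (y, \<phi> y)" "(0, w x - w y)"] by simp
    also have "\<dots> \<le> (m * (2 * \<bar>x - y\<bar>)) * 2 + m * \<bar>x - y\<bar>"
    proof (intro add_mono mult_mono vec bound)
      have "\<bar>\<phi> x - \<phi> y\<bar> \<le> 1 * \<bar>x - y\<bar>"
        using admissible_lipschitz[OF adm, of x y] L_le
        by (meson abs_ge_zero mult_right_mono order_trans)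
      then have "dist (x, \<phi> x) (y, \<phi> y) \<le> 2 * \<bar>x - y\<bar>"
        using norm_Pair_le[of "x - y" "\<phi> x - \<phi> y"] by (simp add: dist_norm)
      then have "m * dist (x, \<phi> x) (y, \<phi> y) \<le> m * (2 * \<bar>x - y\<bar>)"
        using m_nonneg by (rule mult_left_mono)
      then show "norm (Dh (x, \<phi> x) - Dh (y, \<phi> y)) \<le> m * (2 * \<bar>x - y\<bar>)"
        using lipschitz_onD[OF lip, of "(x, \<phi> x)" "(y, \<phi> y)"] by (simp add: dist_norm)
      show "norm (0 :: real, w x - w y) \<le> \<bar>x - y\<bar>"
        using adm lipschitz_onD[of 1 UNIV w x y]
        by (simp add: admissible_def norm_Pair dist_real_def)
    qed (use m_nonneg in auto)
    finally show ?thesis by simp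
  qed
  ultimately show thesis using that by blast
qed

text \<open>In the old parameter \<open>x\<close> the new slope is \<open>v' x / u' x\<close>. It
  has to be bounded by \<open>L\<close>, and to be 1-Lipschitz with respect to the new parameter
  \<open>u x\<close>.\<close>

lemma transform_admissible:
  assumes adm: "admissible \<phi> w"
  shows "\<exists>w'. admissible (transform \<phi>) w'" and "transform \<phi> (base \<phi> x) = fibre \<phi> x"
    and "surj (base \<phi>)"
proof -
  \<comment> \<open>Lower bound for the derivative of \<open>base \<phi>\<close>: the twist may cost
    \<open>a * L\<close>, the perturbation \<open>2 * m\<close>.\<close>
  define d where "d = 1 - a * L - 2 * m"
  have d: "d > 0" using base_expansion by (simp add: d_def)
  have \<phi>: "\<And>x. \<phi> (x + 2 * pi) = \<phi> x" "\<And>x. \<bar>\<phi> x\<bar> \<le> 1"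
      "\<And>x. (\<phi> has_real_derivative w x) (at x)" "\<And>x. \<bar>w x\<bar> \<le> L"
      "\<And>x y. \<bar>w x - w y\<bar> \<le> \<bar>x - y\<bar>"
    using adm by (auto simp: admissible_def lipschitz_on_def dist_real_def)
  obtain f' where f': "\<And>x. ((\<lambda>x. f (x, \<phi> x)) has_real_derivative f' x) (at x)"
      "\<And>x. \<bar>f' x\<bar> \<le> 2 * m" "\<And>x y. \<bar>f' x - f' y\<bar> \<le> 5 * m * \<bar>x - y\<bar>"
    using derivative_along_graph[OF adm derivative(1) derivative_bound(1) derivative_lipschitz(1)]
    by blast
  obtain g' where g': "\<And>x. ((\<lambda>x. g (x, \<phi> x)) has_real_derivative g' x) (at x)"
      "\<And>x. \<bar>g' x\<bar> \<le> 2 * m" "\<And>x y. \<bar>g' x - g' y\<bar> \<le> 5 * m * \<bar>x - y\<bar>"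
    using derivative_along_graph[OF adm derivative(2) derivative_bound(2) derivative_lipschitz(2)]
    by blast
  define u u' v' where "u = base \<phi>" and "u' x = 1 + a * w x + f' x"
    and "v' x = lam * w x + g' x" for x
  have du: "(u has_real_derivative u' x) (at x)" for x
    unfolding u_def u'_def base_def
    by (auto intro!: derivative_eq_intros f' \<phi>(3))
  have dv: "(fibre \<phi> has_real_derivative v' x) (at x)" for x
    unfolding v'_def fibre_def
    by (auto intro!: derivative_eq_intros g' \<phi>(3))
  have low: "d \<le> u' x" for x
  proof -
    have "\<bar>a * w x\<bar> \<le> a * L" using \<phi>(4)[of x] nonneg by (simp add: abs_mult mult_left_mono)
    then show ?thesis using f'(2)[of x] by (simp add: d_def u'_def abs_le_iff)
  qed
  have bij: "bij u" by (rule derivative_bounded_below_bij[OF du low d])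
  have ui: "u (inv u x) = x" and iu: "inv u (u x) = x" for x
    using bij by (auto simp: bij_is_surj surj_f_inv_f bij_is_inj)
  have expand: "d * \<bar>x - y\<bar> \<le> \<bar>u x - u y\<bar>" for x y
    by (rule derivative_bounded_below_expanding[OF du low d])
  show "surj (base \<phi>)" using bij by (simp add: bij_is_surj u_def)
  show "transform \<phi> (base \<phi> x) = fibre \<phi> x"
    using iu by (simp add: transform_def u_def)
  define s where "s x = v' x / u' x" for x
  have upos: "u' x > 0" for x using low[of x] d by linarith
  have v'_bound: "\<bar>v' x\<bar> \<le> L * d" for x
  proof -
    have "\<bar>lam * w x\<bar> \<le> lam * L" using \<phi>(4)[of x] nonneg by (simp add: abs_mult mult_left_mono)
    then have "\<bar>v' x\<bar> \<le> lam * L + 2 * m" using g'(2)[of x] by (simp add: v'_def abs_le_iff)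
    then show ?thesis using slope_condition by (simp add: d_def)
  qed
  have s_bound: "\<bar>s x\<bar> \<le> L" for x
  proof -
    have "\<bar>v' x\<bar> \<le> L * u' x"
      using v'_bound[of x] mult_left_mono[OF low[of x] nonneg(3)] by linarith
    then show ?thesis using upos[of x] by (simp add: s_def field_simps)
  qed
  have v'_lip: "\<bar>v' x - v' y\<bar> \<le> (lam + 5 * m) * \<bar>x - y\<bar>" for x y
  proof -
    have "v' x - v' y = lam * (w x - w y) + (g' x - g' y)" by (simp add: v'_def algebra_simps)
    then have "\<bar>v' x - v' y\<bar> \<le> lam * \<bar>w x - w y\<bar> + \<bar>g' x - g' y\<bar>"
      using nonneg by (metis abs_mult abs_of_nonneg abs_triangle_ineq)
    also have "\<dots> \<le> lam * \<bar>x - y\<bar> + 5 * m * \<bar>x - y\<bar>"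
      using nonneg by (intro add_mono mult_left_mono \<phi> g') auto
    finally show ?thesis by (simp add: algebra_simps)
  qed
  have u'_lip: "\<bar>u' x - u' y\<bar> \<le> (a + 5 * m) * \<bar>x - y\<bar>" for x y
  proof -
    have "u' x - u' y = a * (w x - w y) + (f' x - f' y)" by (simp add: u'_def algebra_simps)
    then have "\<bar>u' x - u' y\<bar> \<le> a * \<bar>w x - w y\<bar> + \<bar>f' x - f' y\<bar>"
      using nonneg by (metis abs_mult abs_of_nonneg abs_triangle_ineq)
    also have "\<dots> \<le> a * \<bar>x - y\<bar> + 5 * m * \<bar>x - y\<bar>"
      using nonneg by (intro add_mono mult_left_mono \<phi> f') auto
    finally show ?thesis by (simp add: algebra_simps)
  qed
  have s_lip: "\<bar>s x - s y\<bar> \<le> \<bar>u x - u y\<bar>" for x y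
  proof -
    \<comment> \<open>Only one denominator is cleared, contributing one factor \<open>d\<close>; the
      expansion of \<open>u\<close> contributes another. Hence the square in
      \<open>curvature_condition\<close>.\<close>
    have "u' x * (s x - s y) = (v' x - v' y) - s y * (u' x - u' y)"
      using upos[of x] upos[of y] by (simp add: s_def field_simps)
    then have "u' x * \<bar>s x - s y\<bar> = \<bar>(v' x - v' y) - s y * (u' x - u' y)\<bar>"
      using upos[of x] by (metis abs_mult abs_of_pos)
    also have "\<dots> \<le> \<bar>v' x - v' y\<bar> + \<bar>s y\<bar> * \<bar>u' x - u' y\<bar>"
      by (metis abs_mult abs_triangle_ineq4)
    also have "\<dots> \<le> (lam + 5 * m) * \<bar>x - y\<bar> + L * ((a + 5 * m) * \<bar>x - y\<bar>)"
      using nonneg by (intro add_mono mult_mono v'_lip u'_lip s_bound) auto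
    also have "\<dots> = (lam + 5 * m + L * (a + 5 * m)) * \<bar>x - y\<bar>" by (simp add: algebra_simps)
    also have "\<dots> \<le> d\<^sup>2 * \<bar>x - y\<bar>"
      using curvature_condition by (intro mult_right_mono) (auto simp: d_def)
    also have "\<dots> = d * (d * \<bar>x - y\<bar>)" by (simp add: power2_eq_square)
    also have "\<dots> \<le> d * \<bar>u x - u y\<bar>" using d expand by (intro mult_left_mono) auto
    finally have "u' x * \<bar>s x - s y\<bar> \<le> d * \<bar>u x - u y\<bar>" .
    moreover have "d * \<bar>s x - s y\<bar> \<le> u' x * \<bar>s x - s y\<bar>"
      using low by (intro mult_right_mono) auto
    ultimately have "d * \<bar>s x - s y\<bar> \<le> d * \<bar>u x - u y\<bar>" by linarith
    then show ?thesis using d by simp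
  qed
  have "admissible (transform \<phi>) (\<lambda>x. s (inv u x))"
    unfolding admissible_def
  proof (intro conjI allI)
    fix x
    \<comment> \<open>\<open>u\<close> lifts a circle map of degree one, so its inverse also
      commutes with translation by the period.\<close>
    have per: "u (y + 2 * pi) = u y + 2 * pi" for y
      using periodic \<phi>(1) by (simp add: u_def base_def periodic_fst_def)
    have "inv u (x + 2 * pi) = inv u x + 2 * pi"
      using iu[of "inv u x + 2 * pi"] by (simp add: per ui)
    then show "transform \<phi> (x + 2 * pi) = transform \<phi> x"
      using periodic \<phi>(1) by (simp add: transform_def fibre_def periodic_fst_def flip: u_def)
    have "\<bar>fibre \<phi> y\<bar> \<le> lam * 1 + m" for y
    proof -
      have "\<bar>fibre \<phi> y\<bar> \<le> \<bar>lam * \<phi> y\<bar> + \<bar>g (y, \<phi> y)\<bar>" unfolding fibre_def by (rule abs_triangle_ineq)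
      also have "\<dots> \<le> lam * 1 + m"
        using nonneg \<phi>(2) g_bound unfolding abs_mult by (intro add_mono mult_mono) auto
      finally show ?thesis .
    qed
    then show "\<bar>transform \<phi> x\<bar> \<le> 1"
      unfolding transform_def using height_condition by (metis order_trans mult_1_right)
    have "((\<lambda>x. fibre \<phi> (inv u x)) has_real_derivative v' (inv u x) * inverse (u' (inv u x))) (at x)"
      by (rule DERIV_chain2[OF dv derivative_bounded_below_inv[OF du low d]])
    then show "(transform \<phi> has_real_derivative s (inv u x)) (at x)"
      by (simp add: transform_def[abs_def] s_def divide_inverse flip: u_def)
    show "\<bar>s (inv u x)\<bar> \<le> L" by (rule s_bound)
    show "1-lipschitz_on UNIV (\<lambda>x. s (inv u x))"
      using s_lip[of "inv u _" "inv u _"] by (intro lipschitz_onI) (auto simp: ui dist_real_def)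
  qed
  then show "\<exists>w'. admissible (transform \<phi>) w'" by blast
qed

section \<open>Vertical contraction and the fixed graph\<close>

text \<open>If the graph of \<open>\<phi>\<close> contains the image of \<open>(x, y2)\<close>, the
  first term on the right vanishes. In this form the estimate serves convergence of the iterates,
  invariance of the limit and attraction alike.\<close>

lemma fibre_contraction:
  assumes lip: "\<And>x y. \<bar>\<phi> x - \<phi> y\<bar> \<le> L * \<bar>x - y\<bar>"
  shows "\<bar>lam * y1 + g (x, y1) - \<phi> (x + c + a * y1 + f (x, y1))\<bar>
    \<le> \<bar>lam * y2 + g (x, y2) - \<phi> (x + c + a * y2 + f (x, y2))\<bar> + rate * \<bar>y1 - y2\<bar>"
proof -
  have lipschitz: "\<bar>h (x, y1) - h (x, y2)\<bar> \<le> m * \<bar>y1 - y2\<bar>"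
    if "\<And>p. (h has_derivative blinfun_apply (Dh p)) (at p)" "\<And>p. norm (Dh p) \<le> m"
    for h :: "real \<times> real \<Rightarrow> real" and Dh
  proof -
    have "norm (h (x, y1) - h (x, y2)) \<le> m * norm ((x, y1) - (x, y2))"
      by (rule differentiable_bound[where S = UNIV and f' = "\<lambda>p. blinfun_apply (Dh p)"])
        (use that in \<open>auto simp flip: norm_blinfun.rep_eq\<close>)
    then show ?thesis by (simp add: norm_Pair)
  qed
  have f: "\<bar>f (x, y1) - f (x, y2)\<bar> \<le> m * \<bar>y1 - y2\<bar>"
    using derivative derivative_bound by (intro lipschitz) auto
  have g: "\<bar>g (x, y1) - g (x, y2)\<bar> \<le> m * \<bar>y1 - y2\<bar>"
    using derivative derivative_bound by (intro lipschitz) auto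
  define u1 u2 where "u1 = x + c + a * y1 + f (x, y1)" and "u2 = x + c + a * y2 + f (x, y2)"
  have ab: "\<bar>k * y1 - k * y2\<bar> = k * \<bar>y1 - y2\<bar>" if "k \<ge> 0" for k
    using that by (simp add: abs_mult flip: right_diff_distrib)
  have "\<bar>u1 - u2\<bar> \<le> (a + m) * \<bar>y1 - y2\<bar>"
    using f ab[OF nonneg(2)] unfolding u1_def u2_def by (simp add: algebra_simps)
  then have "L * \<bar>u1 - u2\<bar> \<le> L * ((a + m) * \<bar>y1 - y2\<bar>)"
    using nonneg by (intro mult_left_mono)
  then have "\<bar>\<phi> u1 - \<phi> u2\<bar> \<le> L * ((a + m) * \<bar>y1 - y2\<bar>)"
    using lip[of u1 u2] by linarith
  moreover have "\<bar>(lam * y1 + g (x, y1)) - (lam * y2 + g (x, y2))\<bar> \<le> (lam + m) * \<bar>y1 - y2\<bar>"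
    using g ab[OF nonneg(1)] by (simp add: algebra_simps)
  moreover have "rate * \<bar>y1 - y2\<bar> = (lam + m) * \<bar>y1 - y2\<bar> + L * ((a + m) * \<bar>y1 - y2\<bar>)"
    by (simp add: rate_def algebra_simps)
  ultimately show ?thesis
    unfolding u1_def[symmetric] u2_def[symmetric] by linarith
qed

theorem invariant_graph:
  obtains \<phi> w where "admissible \<phi> w" "\<And>x. \<phi> (base \<phi> x) = fibre \<phi> x" "surj (base \<phi>)"
proof -
  define \<Phi> where "\<Phi> n = (transform ^^ n) (\<lambda>_. 0)" for n
  have \<Phi>_Suc: "\<Phi> (Suc n) = transform (\<Phi> n)" for n by (simp add: \<Phi>_def)
  have "\<exists>w. admissible (\<Phi> n) w" for n
  proof (induction n)
    case 0
    have "admissible (\<Phi> 0) (\<lambda>_. 0)"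
      using nonneg by (auto simp: admissible_def \<Phi>_def lipschitz_on_def)
    then show ?case by blast
  next
    case (Suc n)
    then show ?case using transform_admissible(1) by (auto simp: \<Phi>_Suc)
  qed
  then obtain w where w: "\<And>n. admissible (\<Phi> n) (w n)" by metis
  have graph: "\<Phi> (Suc n) (base (\<Phi> n) x) = fibre (\<Phi> n) x" for n x
    unfolding \<Phi>_Suc by (rule transform_admissible(2)[OF w])
  note lip = admissible_lipschitz[OF w]
  \<comment> \<open>The induction starts from the height bound 1, since \<open>\<Phi> 0\<close> is
    zero.\<close>
  have step: "\<bar>\<Phi> (Suc n) x - \<Phi> n x\<bar> \<le> rate ^ n" for n x
  proof (induction n arbitrary: x)
    case 0
    have "\<bar>\<Phi> (Suc 0) x\<bar> \<le> 1" using w[of "Suc 0"] unfolding admissible_def by blast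
    then show ?case by (simp add: \<Phi>_def)
  next
    case (Suc n)
    \<comment> \<open>The points of \<open>\<Phi> (Suc n)\<close> and \<open>\<Phi> n\<close> over
      the same \<open>z\<close> are compared: the image of the first lies over \<open>x\<close> on
      the graph of \<open>\<Phi> (Suc (Suc n))\<close>, that of the second on the graph of
      \<open>\<Phi> (Suc n)\<close>.\<close>
    obtain z where z: "x = base (\<Phi> (Suc n)) z"
      using transform_admissible(3)[OF w] by (metis surjD)
    have "\<bar>\<Phi> (Suc (Suc n)) x - \<Phi> (Suc n) x\<bar> \<le> 0 + rate * \<bar>\<Phi> (Suc n) z - \<Phi> n z\<bar>"
      using fibre_contraction[OF lip[of "Suc n"], of "\<Phi> (Suc n) z" z "\<Phi> n z"]
        graph[of "Suc n" z] graph[of n z]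
      by (simp add: z base_def fibre_def)
    also have "\<dots> \<le> rate * rate ^ n"
      using mult_left_mono[OF Suc rate_bounds(1)] by simp
    finally show ?case by simp
  qed
  have "uniformly_convergent_on UNIV (\<lambda>n x. \<Sum>i<n. \<Phi> (Suc i) x - \<Phi> i x)"
    by (rule Weierstrass_m_test'[where M = "\<lambda>n. rate ^ n"])
      (use step rate_bounds in \<open>auto intro!: summable_geometric\<close>)
  moreover have "(\<Sum>i<n. \<Phi> (Suc i) x - \<Phi> i x) = \<Phi> n x" for n x
    using sum_lessThan_telescope[of "\<lambda>i. \<Phi> i x" n] by (simp add: \<Phi>_def)
  ultimately obtain \<phi> where lim: "uniform_limit UNIV \<Phi> \<phi> sequentially"
    by (auto simp: uniformly_convergent_on_def)
  obtain w' where w': "\<And>x. (\<phi> has_real_derivative w' x) (at x)" "\<And>x. (\<lambda>n. w n x) \<longlonglongrightarrow> w' x"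
    by (rule uniform_limit_lipschitz_derivatives[OF _ _ lim, of w 1])
      (use w in \<open>auto simp: admissible_def\<close>)
  have lim': "(\<lambda>n. \<Phi> n x) \<longlonglongrightarrow> \<phi> x" for x
    by (rule tendsto_uniform_limitI[OF lim]) simp
  have adm: "admissible \<phi> w'"
    unfolding admissible_def
  proof (intro conjI allI)
    fix x
    have "(\<lambda>n. \<Phi> n (x + 2 * pi)) \<longlonglongrightarrow> \<phi> x"
      using lim'[of x] w by (simp add: admissible_def)
    then show "\<phi> (x + 2 * pi) = \<phi> x" using lim' LIMSEQ_unique by blast
    show "\<bar>\<phi> x\<bar> \<le> 1"
      by (rule LIMSEQ_le_const2[OF tendsto_rabs[OF lim']]) (use w in \<open>auto simp: admissible_def\<close>)
    show "\<bar>w' x\<bar> \<le> L"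
      by (rule LIMSEQ_le_const2[OF tendsto_rabs[OF w'(2)]])
        (use w in \<open>auto simp: admissible_def\<close>)
    show "1-lipschitz_on UNIV w'"
    proof (rule lipschitz_onI)
      fix x y
      have "dist (w n x) (w n y) \<le> 1 * dist x y" for n
        using w[of n] by (auto simp: admissible_def lipschitz_on_def)
      then show "dist (w' x) (w' y) \<le> 1 * dist x y"
        by (intro LIMSEQ_le_const2[OF tendsto_dist[OF w'(2) w'(2)]]) auto
    qed simp
  qed (rule w')
  have "\<phi> (base \<phi> x) = fibre \<phi> x" for x
  proof -
    \<comment> \<open>Passing to the limit in the contraction estimate avoids any discussion of the
      convergence of the inverses of \<open>base (\<Phi> n)\<close>.\<close>
    have "(\<lambda>n. \<bar>fibre \<phi> x - \<Phi> (Suc n) (base \<phi> x)\<bar>) \<longlonglongrightarrow> \<bar>fibre \<phi> x - \<phi> (base \<phi> x)\<bar>"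
      by (intro tendsto_intros LIMSEQ_Suc lim')
    moreover have "(\<lambda>n. rate * \<bar>\<phi> x - \<Phi> n x\<bar>) \<longlonglongrightarrow> rate * \<bar>\<phi> x - \<phi> x\<bar>"
      by (intro tendsto_intros lim')
    moreover have "\<bar>fibre \<phi> x - \<Phi> (Suc n) (base \<phi> x)\<bar> \<le> rate * \<bar>\<phi> x - \<Phi> n x\<bar>" for n
      using fibre_contraction[OF lip[of "Suc n"], of "\<phi> x" x "\<Phi> n x"] graph[of n x]
      by (simp add: base_def fibre_def)
    ultimately have "\<bar>fibre \<phi> x - \<phi> (base \<phi> x)\<bar> \<le> rate * \<bar>\<phi> x - \<phi> x\<bar>"
      by (intro LIMSEQ_le) auto
    then show ?thesis by simp
  qed
  then show thesis using that adm transform_admissible(3)[OF adm] by blast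
qed

end

section \<open>Bounds for the perturbation and admissible parameters\<close>

lemma bounded_C2_norm_first_derivative:
  assumes "bounded_C2_norm f"
  obtains M Df where "M \<ge> 1" "\<And>p. (f has_derivative blinfun_apply (Df p)) (at p)" "\<And>p. \<bar>f p\<bar> \<le> M"
    "\<And>p. norm (Df p) \<le> M" "\<And>p q. norm (Df p - Df q) \<le> M * norm (p - q)"
proof -
  obtain D1 and D2 :: "real \<times> real \<Rightarrow> (real \<times> real) \<Rightarrow>\<^sub>L (real \<times> real) \<Rightarrow>\<^sub>L real"
    where D: "\<And>p. (f has_derivative blinfun_apply (D1 p)) (at p)"
      "\<And>p. (D1 has_derivative blinfun_apply (D2 p)) (at p)"
      and bdd: "bounded (range f)" "bounded (range D1)" "bounded (range D2)"
    using assms unfolding bounded_C2_norm_def by blast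
  obtain a0 a1 a2 where a: "\<And>p. \<bar>f p\<bar> \<le> a0" "\<And>p. norm (D1 p) \<le> a1" "\<And>p. norm (D2 p) \<le> a2"
    using bdd unfolding bounded_iff by auto
  define M where "M = Max {1, a0, a1, a2}"
  have M: "1 \<le> M" "a0 \<le> M" "a1 \<le> M" "a2 \<le> M" by (auto simp: M_def)
  show thesis
  proof (rule that[of M D1])
    show "norm (D1 p - D1 q) \<le> M * norm (p - q)" for p q
      by (rule differentiable_bound[where S = UNIV and f' = "\<lambda>p. blinfun_apply (D2 p)"])
        (use D order_trans[OF a(3) M(4)] in \<open>simp_all flip: norm_blinfun.rep_eq\<close>)
    show "\<bar>f p\<bar> \<le> M" "norm (D1 p) \<le> M" for p
      using a(1,2)[of p] M by simp_all
  qed (use D M in auto)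
qed

lemma one_minus_exp_bounds:
  fixes \<eta> :: real
  assumes "0 < \<eta>" "\<eta> \<le> 1 / 8"
  shows "3 * \<eta> \<le> 1 - exp (- 2 * pi * \<eta>)" "1 - exp (- 2 * pi * \<eta>) \<le> 7 * \<eta>"
proof -
  define x where "x = 2 * pi * \<eta>"
  have pi: "3 < pi" "pi < 3.5" using pi_gt3 pi_less_4 pi_approx by auto
  have x: "6 * \<eta> \<le> x" "x \<le> 7 * \<eta>" "0 < x"
    using pi assms by (auto simp: x_def)
  have "exp (- x) \<ge> 1 - x" using exp_ge_add_one_self[of "- x"] by simp
  then show "1 - exp (- 2 * pi * \<eta>) \<le> 7 * \<eta>" using x by (simp add: x_def)
  have "exp (- x) \<le> 1 / (1 + x)"
    using exp_ge_add_one_self[of x] x by (simp add: exp_minus field_simps)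
  \<comment> \<open>This is equivalent to \<open>x \<le> 1\<close>, which holds because
    \<open>x \<le> 7 * \<eta> \<le> 7 / 8\<close>.\<close>
  also have "\<dots> \<le> 1 - x / 2"
  proof -
    have "x * x \<le> x * 1" using x assms by (intro mult_left_mono) auto
    then show ?thesis using x by (simp add: field_simps)
  qed
  finally show "3 * \<eta> \<le> 1 - exp (- 2 * pi * \<eta>)" using x(1) by (simp add: x_def)
qed

text \<open>The choice of \<open>L\<close> makes \<open>a * L\<close> one fourteenth of the gain
  \<open>1 - lam\<close>. In the slope condition the gain carries a factor \<open>L\<close> but the
  loss \<open>2 * m\<close> does not, so \<open>m\<close> must be of order
  \<open>\<eta>\<^sup>2\<close>; this is the origin of the threshold
  \<open>K * sqrt \<epsilon>\<close>.\<close>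

lemma dissipative_twist_parameters:
  fixes \<eta> m :: real
  assumes \<eta>: "0 < \<eta>" "\<eta> \<le> 1 / 8" and m: "0 \<le> m" "30 * m \<le> \<eta>\<^sup>2"
  defines "lam \<equiv> exp (- 2 * pi * \<eta>)"
  defines "a \<equiv> (1 - lam) / \<eta>" and "L \<equiv> \<eta> / 14"
  shows "0 \<le> lam" "0 \<le> a" "0 \<le> L" "L \<le> 1" "0 < 1 - a * L - 2 * m"
    "lam * L + 2 * m \<le> L * (1 - a * L - 2 * m)"
    "lam + 5 * m + L * (a + 5 * m) \<le> (1 - a * L - 2 * m)\<^sup>2"
    "lam + m \<le> 1" "lam + m + L * (a + m) < 1"
proof -
  note b = one_minus_exp_bounds[OF \<eta>]
  have lam: "3 * \<eta> \<le> 1 - lam" "1 - lam \<le> 7 * \<eta>" "0 \<le> lam" using b by (auto simp: lam_def)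
  have aL: "a * L = (1 - lam) / 14" using \<eta> by (simp add: a_def L_def)
  have "\<eta>\<^sup>2 \<le> 1 / 8 * \<eta>" using \<eta> by (simp add: power2_eq_square)
  then have m2: "240 * m \<le> \<eta>" using m by linarith
  have Lm: "L * m \<le> m" "0 \<le> L * m" using \<eta> m mult_right_mono[of L 1 m] by (auto simp: L_def)
  show "0 \<le> lam" "0 \<le> L" "L \<le> 1" using lam \<eta> by (auto simp: L_def)
  show "0 \<le> a" using lam \<eta> by (simp add: a_def)
  show "0 < 1 - a * L - 2 * m" "lam + m \<le> 1"
    using lam m m2 \<eta> aL by simp_all
  show "lam + m + L * (a + m) < 1" using lam m m2 \<eta> aL Lm by (simp add: algebra_simps)
  show "lam + 5 * m + L * (a + 5 * m) \<le> (1 - a * L - 2 * m)\<^sup>2"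
  proof -
    \<comment> \<open>It then suffices that
      \<open>3 * (a * L) + 9 * m + 5 * (L * m) \<le> 1 - lam\<close>, which is linear in the known
      bounds.\<close>
    have "1 - 2 * (a * L + 2 * m) \<le> (1 - a * L - 2 * m)\<^sup>2"
      using zero_le_power2[of "a * L + 2 * m"] by (simp add: power2_eq_square algebra_simps)
    then show ?thesis using lam m m2 \<eta> aL Lm by (simp add: algebra_simps)
  qed
  show "lam * L + 2 * m \<le> L * (1 - a * L - 2 * m)"
  proof -
    \<comment> \<open>The resulting \<open>39 / 196\<close> exceeds \<open>4 / 30\<close>, leaving
      \<open>4 * m\<close> to cover \<open>2 * m\<close> and \<open>2 * (L * m)\<close>.\<close>
    have "L * (13 / 14 * (1 - lam)) \<ge> L * (13 / 14 * (3 * \<eta>))"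
      using lam \<eta> by (intro mult_left_mono) (auto simp: L_def)
    also have "L * (13 / 14 * (3 * \<eta>)) = 39 / 196 * \<eta>\<^sup>2" by (simp add: L_def power2_eq_square)
    finally have "4 * m \<le> L * (13 / 14 * (1 - lam))" using m by linarith
    moreover have "L * (1 - a * L - 2 * m) - (lam * L + 2 * m)
        = L * (13 / 14 * (1 - lam)) - 2 * (L * m) - 2 * m"
      unfolding aL by (simp add: field_simps)
    ultimately show ?thesis using Lm by linarith
  qed
qed

section \<open>The invariant circle\<close>

text \<open>The vertical distance \<open>E\<close> to the graph dominates the distance to
  \<open>C\<close> and decays like \<open>q ^ n\<close> along every orbit. In a bounded invariant
  set, preimages of every order have bounded \<open>E\<close>, which forces \<open>E\<close> to
  vanish.\<close>

lemma unique_attracting_graph: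
  fixes Q :: "circle \<times> real \<Rightarrow> circle \<times> real" and \<psi> :: "circle \<Rightarrow> real"
  defines "C \<equiv> {(t, \<psi> t) | t. True}"
  assumes inv: "invariant Q C" and C1: "C1_circle C" and bound: "\<And>t. \<bar>\<psi> t\<bar> \<le> 1"
    and q: "0 \<le> q" "q < 1"
    and contr: "\<And>p. \<bar>snd (Q p) - \<psi> (fst (Q p))\<bar> \<le> q * \<bar>snd p - \<psi> (fst p)\<bar>"
  shows "C \<subseteq> UNIV \<times> {-1..1}" "basin Q C = UNIV" "attractive Q C"
    "C1_circle C' \<Longrightarrow> C' \<subseteq> UNIV \<times> {-1..1} \<Longrightarrow> invariant Q C' \<Longrightarrow> C' = C"
proof -
  define E where "E p = \<bar>snd p - \<psi> (fst p)\<bar>" for p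
  have E: "E ((Q ^^ n) p) \<le> q ^ n * E p" for n p
  proof (induction n)
    case (Suc n)
    have "E ((Q ^^ Suc n) p) \<le> q * E ((Q ^^ n) p)" using contr by (simp add: E_def)
    also have "\<dots> \<le> q * (q ^ n * E p)" using Suc q by (intro mult_left_mono)
    finally show ?case by (simp add: mult.assoc)
  qed simp
  have q0: "(\<lambda>n. q ^ n * r) \<longlonglongrightarrow> 0" for r
    using tendsto_mult_right[OF LIMSEQ_realpow_zero[OF q], of r] by simp
  show "C \<subseteq> UNIV \<times> {-1..1}" using bound by (fastforce simp: C_def abs_le_iff)
  have dist: "infdist p C \<le> E p" for p
  proof -
    have "infdist p C \<le> dist p (fst p, \<psi> (fst p))" by (rule infdist_le) (auto simp: C_def)
    also have "\<dots> = E p" by (cases p) (simp add: dist_Pair_Pair E_def dist_real_def)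
    finally show ?thesis .
  qed
  have "(\<lambda>n. infdist ((Q ^^ n) p) C) \<longlonglongrightarrow> 0" for p
    by (rule tendsto_sandwich[OF _ _ tendsto_const q0[of "E p"]])
      (auto intro!: always_eventually infdist_nonneg order_trans[OF dist E])
  then show basin: "basin Q C = UNIV" by (auto simp: basin_def)
  then show "attractive Q C" by (auto simp: attractive_def)
  show "C' = C" if C': "C1_circle C'" "C' \<subseteq> UNIV \<times> {-1..1}" "invariant Q C'"
  proof -
    have "E p = 0" if "p \<in> C'" for p
    proof -
      have "(Q ^^ n) ` C' = C'" for n
        using C'(3) by (induction n) (simp_all add: invariant_def flip: image_image)
      then have "\<exists>r\<in>C'. p = (Q ^^ n) r" for n using that by blast
      then obtain r where r: "\<And>n. r n \<in> C'" "\<And>n. p = (Q ^^ n) (r n)" by metis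
      \<comment> \<open>The strip bounds \<open>E\<close> by 2 at every preimage \<open>r n\<close>,
        uniformly in \<open>n\<close>.\<close>
      have "E p \<le> q ^ n * 2" for n
      proof -
        have "\<bar>snd (r n)\<bar> \<le> 1" using r(1)[of n] C'(2) by (auto simp: mem_Times_iff abs_le_iff)
        then have "E (r n) \<le> 2" using bound[of "fst (r n)"] by (simp add: E_def)
        then have "q ^ n * E (r n) \<le> q ^ n * 2" using q by (intro mult_left_mono) auto
        then show ?thesis using E[of n "r n"] r(2)[of n] by simp
      qed
      then have "E p \<le> 0" by (intro LIMSEQ_le_const[OF q0]) auto
      then show ?thesis by (simp add: E_def)
    qed
    \<comment> \<open>Vanishing of \<open>E\<close> puts \<open>C'\<close> inside \<open>C\<close>;
      both being graphs over the whole circle, they coincide.\<close>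
    moreover obtain \<rho> where "C' = {(t, \<rho> t) | t. True}" using C'(1) by (auto simp: C1_circle_def)
    ultimately have "\<rho> t = \<psi> t" for t by (force simp: E_def)
    then show ?thesis by (simp add: C_def \<open>C' = _\<close>)
  qed
qed

text \<open>The locale predicate does not take the rotation, so \<open>c\<close> can be set to
  \<open>2 * pi * \<nu>\<close> for any \<open>\<nu>\<close>. The periodic graph on the line then
  descends to the cylinder.\<close>

lemma Qmap_invariant_circle:
  assumes per: "periodic_fst f" "periodic_fst g"
    and tw: "dissipative_twist (\<lambda>p. \<epsilon> * f p) (\<lambda>p. \<epsilon> * g p) Df Dg
      ((1 - exp (- 2 * pi * \<eta>)) / \<eta>) (exp (- 2 * pi * \<eta>)) m L"
  obtains \<psi> :: "circle \<Rightarrow> real" and q :: real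
  where "invariant (Qmap f g \<nu> \<epsilon> \<eta>) {(t, \<psi> t) | t. True}" "C1_circle {(t, \<psi> t) | t. True}"
    "\<And>t. \<bar>\<psi> t\<bar> \<le> 1" "0 \<le> q" "q < 1"
    "\<And>p. \<bar>snd (Qmap f g \<nu> \<epsilon> \<eta> p) - \<psi> (fst (Qmap f g \<nu> \<epsilon> \<eta> p))\<bar> \<le> q * \<bar>snd p - \<psi> (fst p)\<bar>"
proof -
  define a lam c where "a = (1 - exp (- 2 * pi * \<eta>)) / \<eta>" and "lam = exp (- 2 * pi * \<eta>)"
    and "c = 2 * pi * \<nu>"
  interpret dissipative_twist "\<lambda>p. \<epsilon> * f p" "\<lambda>p. \<epsilon> * g p" Df Dg c a lam m L
    using tw unfolding a_def lam_def .
  let ?Q = "Qmap f g \<nu> \<epsilon> \<eta>"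
  obtain \<phi> w where \<phi>: "admissible \<phi> w" "\<And>x. \<phi> (base \<phi> x) = fibre \<phi> x" "surj (base \<phi>)"
    using invariant_graph by blast
  define \<psi> where "\<psi> t = \<phi> (circle_rep t)" for t
  have periodic\<phi>: "periodic_fst (\<lambda>p. \<phi> (fst p))"
    using \<phi>(1) by (simp add: periodic_fst_def admissible_def)
  have \<psi>: "\<psi> (angle x) = \<phi> x" for x
  proof -
    obtain k :: int where "circle_rep (angle x) - x = 2 * pi * of_int k"
      using angle_circle_rep[of "angle x"] unfolding angle_eq_iff by blast
    then have "circle_rep (angle x) = x + 2 * pi * of_int k" by simp
    then show ?thesis using periodic_fst_int[OF periodic\<phi>, of x k] by (simp add: \<psi>_def)
  qed
  have Q: "?Q (angle x, y) =
      (angle (x + c + a * y + \<epsilon> * f (x, y)), lam * y + \<epsilon> * g (x, y))" for x y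
    by (simp add: Qmap_angle[OF per] a_def lam_def c_def mult.commute)
  have Q\<phi>: "?Q (angle x, \<phi> x) = (angle (base \<phi> x), \<phi> (base \<phi> x))" for x
    unfolding \<phi>(2) by (simp add: Q base_def fibre_def)
  have graph: "{(t, \<psi> t) | t. True} = range (\<lambda>x. (angle x, \<phi> x))"
    by (auto simp: image_iff \<psi>) (metis angle_circle_rep \<psi>)
  show thesis
  proof (rule that[of \<psi> rate])
    \<comment> \<open>The image of the graph is the graph reparametrised by
      \<open>base \<phi>\<close>; surjectivity turns inclusion into the equality that
      \<open>invariant\<close> demands.\<close>
    have "?Q ` range (\<lambda>x. (angle x, \<phi> x)) = (\<lambda>x. (angle x, \<phi> x)) ` range (base \<phi>)"
      by (simp add: image_image Q\<phi>)
    then show "invariant ?Q {(t, \<psi> t) | t. True}"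
      unfolding invariant_def graph by (simp add: \<phi>(3))
    have "continuous_on UNIV w"
      using \<phi>(1) by (auto simp: admissible_def intro: lipschitz_on_continuous_on)
    then have "\<phi> C1_differentiable_on UNIV"
      using \<phi>(1) unfolding C1_differentiable_on_def admissible_def
      by (auto simp: has_real_derivative_iff_has_vector_derivative)
    then show "C1_circle {(t, \<psi> t) | t. True}"
      unfolding C1_circle_def by (auto simp: \<psi> intro!: exI[of _ \<psi>])
    show "\<bar>\<psi> t\<bar> \<le> 1" for t using \<phi>(1) by (simp add: \<psi>_def admissible_def)
    fix p :: "circle \<times> real"
    obtain x y where p: "p = (angle x, y)" by (metis angle_circle_rep surj_pair)
    show "\<bar>snd (?Q p) - \<psi> (fst (?Q p))\<bar> \<le> rate * \<bar>snd p - \<psi> (fst p)\<bar>"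
      using fibre_contraction[OF admissible_lipschitz[OF \<phi>(1)], of y x "\<phi> x"] \<phi>(2)[of x]
      by (simp add: p Q \<psi> base_def fibre_def)
  qed (rule rate_bounds)+
qed

theorem theorem1p1:
  fixes f g :: "real \<times> real \<Rightarrow> real"
  assumes "real_analytic2 f" and "real_analytic2 g"
    and "periodic_fst f" and "periodic_fst g"
    and "bounded_C2_norm f" and "bounded_C2_norm g"
  shows "\<exists>\<epsilon>0>0. \<exists>\<eta>0>0. \<exists>K>0. \<forall>\<nu> \<epsilon> \<eta> :: real.
    0 < \<epsilon> \<and> \<epsilon> \<le> \<epsilon>0 \<and> K * sqrt \<epsilon> \<le> \<eta> \<and> \<eta> \<le> \<eta>0 \<longrightarrow>
    (\<exists>C. (C1_circle C \<and> C \<subseteq> UNIV \<times> {-1..1} \<and>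
          invariant (Qmap f g \<nu> \<epsilon> \<eta>) C \<and> attractive (Qmap f g \<nu> \<epsilon> \<eta>) C) \<and>
         (\<forall>C'. C1_circle C' \<and> C' \<subseteq> UNIV \<times> {-1..1} \<and>
               invariant (Qmap f g \<nu> \<epsilon> \<eta>) C' \<and> attractive (Qmap f g \<nu> \<epsilon> \<eta>) C' \<longrightarrow> C' = C) \<and>
         basin (Qmap f g \<nu> \<epsilon> \<eta>) C = UNIV)"
proof -
  obtain Mf Df where f: "Mf \<ge> 1" "\<And>p. (f has_derivative blinfun_apply (Df p)) (at p)"
      "\<And>p. \<bar>f p\<bar> \<le> Mf" "\<And>p. norm (Df p) \<le> Mf" "\<And>p q. norm (Df p - Df q) \<le> Mf * norm (p - q)"
    using bounded_C2_norm_first_derivative[OF assms(5)] by blast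
  obtain Mg Dg where g: "Mg \<ge> 1" "\<And>p. (g has_derivative blinfun_apply (Dg p)) (at p)"
      "\<And>p. \<bar>g p\<bar> \<le> Mg" "\<And>p. norm (Dg p) \<le> Mg" "\<And>p q. norm (Dg p - Dg q) \<le> Mg * norm (p - q)"
    using bounded_C2_norm_first_derivative[OF assms(6)] by blast
  define M where "M = max Mf Mg"
  have M: "M \<ge> 1" "Mf \<le> M" "Mg \<le> M" using f(1) by (auto simp: M_def)
  show ?thesis
  \<comment> \<open>The smallness of \<open>\<epsilon>\<close> comes from
    \<open>30 * M * sqrt \<epsilon> \<le> \<eta> \<le> 1 / 8\<close>, so 1 serves as its
    bound.\<close>
  proof (rule exI[of _ 1], rule conjI[OF zero_less_one], rule exI[of _ "1 / 8"], rule conjI[rotated],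
      rule exI[of _ "30 * M"], rule conjI[rotated], intro allI impI)
    fix \<nu> \<epsilon> \<eta> :: real
    assume *: "0 < \<epsilon> \<and> \<epsilon> \<le> 1 \<and> 30 * M * sqrt \<epsilon> \<le> \<eta> \<and> \<eta> \<le> 1 / 8"
    then have \<epsilon>: "0 < \<epsilon>" by simp
    have "0 < 30 * M * sqrt \<epsilon>" using M \<epsilon> by simp
    then have \<eta>: "0 < \<eta>" "\<eta> \<le> 1 / 8" using * by auto
    \<comment> \<open>Squaring \<open>K * sqrt \<epsilon> \<le> \<eta>\<close> and dropping a factor
      \<open>30 * M \<ge> 1\<close> leaves the parameter condition for
      \<open>m = \<epsilon> * M\<close>.\<close>
    have "(30 * M * sqrt \<epsilon>)\<^sup>2 \<le> \<eta>\<^sup>2" using * M \<epsilon> by (intro power_mono) auto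
    moreover have "(30 * M * sqrt \<epsilon>)\<^sup>2 = 30 * M * (30 * (\<epsilon> * M))"
      using \<epsilon> by (simp add: power_mult_distrib) (simp add: power2_eq_square)
    moreover have "1 * (30 * (\<epsilon> * M)) \<le> 30 * M * (30 * (\<epsilon> * M))"
      using M \<epsilon> by (intro mult_right_mono) auto
    ultimately have m: "30 * (\<epsilon> * M) \<le> \<eta>\<^sup>2" "0 \<le> \<epsilon> * M"
      using M \<epsilon> by (linarith, simp)
    have lip: "(\<epsilon> * M)-lipschitz_on UNIV (\<lambda>p. \<epsilon> *\<^sub>R D p)"
      if "\<And>p q. norm (D p - D q) \<le> M' * norm (p - q)" "M' \<le> M"
      for D :: "real \<times> real \<Rightarrow> (real \<times> real) \<Rightarrow>\<^sub>L real" and M'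
    proof (rule lipschitz_onI)
      fix p q
      have "norm (D p - D q) \<le> M * norm (p - q)"
        using that(1)[of p q] mult_right_mono[OF that(2), of "norm (p - q)"] by simp
      then have "\<epsilon> * norm (D p - D q) \<le> \<epsilon> * (M * norm (p - q))" using \<epsilon> by simp
      then show "dist (\<epsilon> *\<^sub>R D p) (\<epsilon> *\<^sub>R D q) \<le> \<epsilon> * M * dist p q"
        using \<epsilon> by (simp add: dist_norm flip: scaleR_diff_right)
    qed (rule m)
    have "dissipative_twist (\<lambda>p. \<epsilon> * f p) (\<lambda>p. \<epsilon> * g p) (\<lambda>p. \<epsilon> *\<^sub>R Df p) (\<lambda>p. \<epsilon> *\<^sub>R Dg p)
        ((1 - exp (- 2 * pi * \<eta>)) / \<eta>) (exp (- 2 * pi * \<eta>)) (\<epsilon> * M) (\<eta> / 14)"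
    proof
      show "periodic_fst (\<lambda>p. \<epsilon> * f p)" "periodic_fst (\<lambda>p. \<epsilon> * g p)"
        using assms(3,4) by (simp_all add: periodic_fst_def)
      fix p
      show "((\<lambda>p. \<epsilon> * f p) has_derivative blinfun_apply (\<epsilon> *\<^sub>R Df p)) (at p)"
        using has_derivative_mult_right[OF f(2), of \<epsilon> p]
        by (simp add: scaleR_blinfun.rep_eq)
      show "((\<lambda>p. \<epsilon> * g p) has_derivative blinfun_apply (\<epsilon> *\<^sub>R Dg p)) (at p)"
        using has_derivative_mult_right[OF g(2), of \<epsilon> p]
        by (simp add: scaleR_blinfun.rep_eq)
      show "norm (\<epsilon> *\<^sub>R Df p) \<le> \<epsilon> * M" "norm (\<epsilon> *\<^sub>R Dg p) \<le> \<epsilon> * M" "\<bar>\<epsilon> * g p\<bar> \<le> \<epsilon> * M"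
        using \<epsilon> f(4)[of p] g(4)[of p] g(3)[of p] M by (simp_all add: abs_mult)
      show "(\<epsilon> * M)-lipschitz_on UNIV (\<lambda>p. \<epsilon> *\<^sub>R Df p)" by (rule lip[OF f(5) M(2)])
      show "(\<epsilon> * M)-lipschitz_on UNIV (\<lambda>p. \<epsilon> *\<^sub>R Dg p)" by (rule lip[OF g(5) M(3)])
    qed (use dissipative_twist_parameters[OF \<eta> m(2,1)] in auto)
    then obtain \<psi> q where \<psi>: "invariant (Qmap f g \<nu> \<epsilon> \<eta>) {(t, \<psi> t) | t. True}"
        "C1_circle {(t, \<psi> t) | t. True}" "\<And>t. \<bar>\<psi> t\<bar> \<le> 1" "0 \<le> q" "q < 1"
        "\<And>p. \<bar>snd (Qmap f g \<nu> \<epsilon> \<eta> p) - \<psi> (fst (Qmap f g \<nu> \<epsilon> \<eta> p))\<bar> \<le> q * \<bar>snd p - \<psi> (fst p)\<bar>"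
      using Qmap_invariant_circle[OF assms(3,4), of \<epsilon> _ _ \<eta> _ _ \<nu>] by blast
    note u = unique_attracting_graph[OF \<psi>(1,2,3,4,5,6)]
    show "\<exists>C. (C1_circle C \<and> C \<subseteq> UNIV \<times> {-1..1} \<and>
          invariant (Qmap f g \<nu> \<epsilon> \<eta>) C \<and> attractive (Qmap f g \<nu> \<epsilon> \<eta>) C) \<and>
         (\<forall>C'. C1_circle C' \<and> C' \<subseteq> UNIV \<times> {-1..1} \<and>
               invariant (Qmap f g \<nu> \<epsilon> \<eta>) C' \<and> attractive (Qmap f g \<nu> \<epsilon> \<eta>) C' \<longrightarrow> C' = C) \<and>
         basin (Qmap f g \<nu> \<epsilon> \<eta>) C = UNIV"
      using \<psi>(1,2) u by (intro exI[of _ "{(t, \<psi> t) | t. True}"] conjI allI impI) (assumption | blast)+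
  qed (use M in auto)
qed

end
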